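(* The smallest value in $\mathcal{M}_{i\sqrt2}$ is $\sqrt{8}$, and it is attained by the billiard $\mathcal{C}_{\frac12}$ induced by the geodesic $\langle \tfrac12,\infty\rangle$, i.e. $\lambda_{i\sqrt2}(\mathcal{C}_{\frac12})=\sqrt8$ and $\lambda_{i\sqrt2}(\mathcal{B})\ge\sqrt8$ for every modular billiard $\mathcal{B}$. Moreover $\sqrt{8}$ is a limit point of $\mathcal{M}_{i\sqrt2}$.
   Context: Let $\mathbb{H}$ be the upper half-plane with hyperbolic metric $ds=|dz|/y$. The group $\Gamma=\mathrm{PGL}(2,\mathbb{Z})$ acts on $\mathbb{H}$: $M=\pm\begin{pmatrix}a&b\\c&d\end{pmatrix}$ with $\det M=1$ acts by $z\mapsto \frac{az+b}{cz+d}$, and with $\det M=-1$ by $z\mapsto \frac{a\bar z+b}{c\bar z+d}$. Let $\mathcal{T}=\{z\in\mathbb{H}: 0\le \mathrm{Re}\,z\le \tfrac12,\ |z|\ge 1\}$. For distinct $\alpha,\beta\in\mathbb{R}\cup\{\infty\}$, $\langle\alpha,\beta\rangle$ denotes the oriented geodesic from $\alpha$ to $\beta$. For an oriented geodesic $S$, the modular billiard $\mathcal{B}$ induced by $S$ is the set of distinct directed geodesic segments in $\mathcal{T}$ of the orbit $\Gamma S$ (i.e. the intersections with $\mathcal{T}$ of the oriented geodesics $gS$, $g\in\Gamma$). For $z\in\mathcal{T}$, $\delta_z(\mathcal{B})$ is the infimum of the hyperbolic distance between points of $\mathcal{B}$ and $z$, $\lambda_z(\mathcal{B})=(\sinh\delta_z(\mathcal{B}))^{-1}$,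 and $\mathcal{M}_z=\{\lambda_z(\mathcal{B}):\mathcal{B}\text{ a modular billiard}\}$. *)

theory Defs
  imports "HOL-Analysis.Analysis"
begin

definition upper_half_plane :: "complex set" where
  "upper_half_plane = {z. Im z > 0}"

text \<open>The lengths, for the metric $ds = |dz|/y$, of the rectifiable piecewise $C^1$ paths from
  \<open>z\<close> to \<open>w\<close>. The predicate \<open>valid_path\<close> does not bound the derivative near break points, so
  a valid path may have infinite length; stating the length with \<open>has_integral\<close> discards such
  paths, whereas \<open>integral\<close> would give them the junk length 0.\<close>

definition hyp_path_lengths :: "complex \<Rightarrow> complex \<Rightarrow> real set" where
  "hyp_path_lengths z w = {L. \<exists>\<gamma>. valid_path \<gamma> \<and> path_image \<gamma> \<subseteq> upper_half_plane \<and>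
     pathstart \<gamma> = z \<and> pathfinish \<gamma> = w \<and>
     ((\<lambda>t. norm (vector_derivative \<gamma> (at t)) / Im (\<gamma> t)) has_integral L) {0..1}}"

definition hyp_dist :: "complex \<Rightarrow> complex \<Rightarrow> real" where
  "hyp_dist z w = Inf (hyp_path_lengths z w)"

text \<open>The boundary of the upper half-plane, with its single point at infinity.\<close>

datatype bdry = Finite real | Infinity

text \<open>An oriented curve is encoded as the order in which it runs through its points: the pair
  \<open>(z, w)\<close> belongs to it iff both points lie on the curve and \<open>z\<close> comes no later than \<open>w\<close>.
  The underlying point set is \<open>Field\<close>, and reversing the orientation is \<open>converse\<close>. Only distinct
  endpoints give a geodesic; for equal endpoints the relation below is empty.\<close>

fun oriented_geodesic :: "bdry \<Rightarrow> bdry \<Rightarrow> complex rel" where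
  "oriented_geodesic (Finite a) Infinity =
     {(z, w). z \<in> upper_half_plane \<and> w \<in> upper_half_plane \<and>
        Re z = a \<and> Re w = a \<and> Im z \<le> Im w}"
| "oriented_geodesic Infinity (Finite b) =
     {(z, w). z \<in> upper_half_plane \<and> w \<in> upper_half_plane \<and>
        Re z = b \<and> Re w = b \<and> Im w \<le> Im z}"
| "oriented_geodesic (Finite a) (Finite b) =
     {(z, w). z \<in> upper_half_plane \<and> w \<in> upper_half_plane \<and>
        dist z (of_real ((a + b) / 2)) = \<bar>b - a\<bar> / 2 \<and>
        dist w (of_real ((a + b) / 2)) = \<bar>b - a\<bar> / 2 \<and>
        (if a < b then Re z \<le> Re w else Re w \<le> Re z)}"
| "oriented_geodesic Infinity Infinity = {}"

text \<open>The action of an integer matrix of determinant 1 or -1 on the upper half-plane. As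
  \<open>M\<close> and \<open>-M\<close> act alike, PGL(2,Z) is represented by the set of its transformations.\<close>

definition matrix_action :: "int^2^2 \<Rightarrow> complex \<Rightarrow> complex" where
  "matrix_action M z =
     (let u = (if det M = 1 then z else cnj z)
      in (of_int (M$1$1) * u + of_int (M$1$2)) / (of_int (M$2$1) * u + of_int (M$2$2)))"

definition PGL2Z :: "(complex \<Rightarrow> complex) set" where
  "PGL2Z = {matrix_action M | M. det M = 1 \<or> det M = -1}"

definition curve_image :: "(complex \<Rightarrow> complex) \<Rightarrow> complex rel \<Rightarrow> complex rel" where
  "curve_image g S = map_prod g g ` S"

definition fundamental_triangle :: "complex set" where
  "fundamental_triangle =
     {z \<in> upper_half_plane. 0 \<le> Re z \<and> Re z \<le> 1/2 \<and> norm z \<ge> 1}"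

text \<open>Translates that miss the triangle contribute no segment.\<close>

definition billiard :: "complex rel \<Rightarrow> complex rel set" where
  "billiard S = {Restr (curve_image g S) fundamental_triangle | g. g \<in> PGL2Z} - {{}}"

definition modular_billiards :: "complex rel set set" where
  "modular_billiards = {billiard (oriented_geodesic \<alpha> \<beta>) | \<alpha> \<beta>. \<alpha> \<noteq> \<beta>}"

definition billiard_points :: "complex rel set \<Rightarrow> complex set" where
  "billiard_points B = (\<Union>s\<in>B. Field s)"

definition billiard_dist :: "complex \<Rightarrow> complex rel set \<Rightarrow> real" where
  "billiard_dist z B = (INF w\<in>billiard_points B. hyp_dist z w)"

text \<open>The value is extended real: a billiard that comes arbitrarily close to \<open>z\<close> has value
  \<open>\<infinity>\<close> (in \<open>real\<close>, the inverse of 0 would be 0).\<close>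

definition billiard_value :: "complex \<Rightarrow> complex rel set \<Rightarrow> ereal" where
  "billiard_value z B = inverse (ereal (sinh (billiard_dist z B)))"

definition billiard_spectrum :: "complex \<Rightarrow> ereal set" where
  "billiard_spectrum z = billiard_value z ` modular_billiards"

definition C_half :: "complex rel set" where
  "C_half = billiard (oriented_geodesic (Finite (1/2)) Infinity)"

end

(* Writing a geodesic as the zero set of A |z|^2 + B Re z + C with D = B^2 - 4 A C > 0, its distance
   delta from i sqrt 2 satisfies sinh delta = |2 A + C| / (sqrt 2 sqrt D). The hyperbolic disc around
   i sqrt 2 with sinh delta <= 1 / sqrt 8 is the Euclidean disc |z - 3i/2| <= 1/2. Its integer
   translates cover the line Im z = 3/2, and it contains the imaginary axis from i to 2i. Every
   geodesic has a translate that is vertical or crosses the imaginary axis, and inversion makes it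
   cross above i, either inside the disc or so high that it also crosses Im z = 3/2. Hence every
   value is at least sqrt 8. For C_half we have D = 4, and 2 A + C is a nonzero integer for every
   equivalent form. For the geodesic from -N/2 to N/2 with N odd, scaled so that D = 16 N^2, the
   minimum of |2 A + C| is at least 2 N - 9 but less than 2 N, so its value exceeds sqrt 8 and tends to it. *)

theory Submission
  imports Defs "HOL-Real_Asymp.Real_Asymp"
begin

subsection \<open>Hyperbolic distance\<close>

lemma hyp_path_lengths_nonneg:
  assumes "L \<in> hyp_path_lengths z w"
  shows "0 \<le> L"
proof -
  obtain \<gamma> where \<gamma>: "path_image \<gamma> \<subseteq> upper_half_plane"
    "((\<lambda>t. norm (vector_derivative \<gamma> (at t)) / Im (\<gamma> t)) has_integral L) {0..1}"
    using assms unfolding hyp_path_lengths_def by blast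
  show ?thesis
    using \<gamma>(1) by (intro has_integral_nonneg[OF \<gamma>(2)] divide_nonneg_nonneg)
      (force simp: path_image_def upper_half_plane_def)+
qed

lemma hyp_dist_le_length:
  assumes "L \<in> hyp_path_lengths z w"
  shows "hyp_dist z w \<le> L"
  unfolding hyp_dist_def
  by (rule cInf_lower[OF assms]) (meson bdd_belowI hyp_path_lengths_nonneg)

text \<open>A curve of hyperbolic speed 1 has the elapsed parameter as its length. Rescaling to
  [0, 1] makes the integrand the constant \<open>\<bar>b - a\<bar>\<close>, in either
  direction.\<close>

lemma unit_speed_length:
  fixes \<gamma> \<gamma>' :: "real \<Rightarrow> complex"
  assumes der: "\<And>t. (\<gamma> has_vector_derivative \<gamma>' t) (at t)"
    and cont: "continuous_on UNIV \<gamma>'"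
    and speed: "\<And>t. norm (\<gamma>' t) = Im (\<gamma> t)"
    and pos: "\<And>t. Im (\<gamma> t) > 0"
  shows "\<bar>b - a\<bar> \<in> hyp_path_lengths (\<gamma> a) (\<gamma> b)"
proof -
  define \<eta> where "\<eta> s = \<gamma> (a + s * (b - a))" for s
  have \<eta>': "(\<eta> has_vector_derivative (b - a) *\<^sub>R \<gamma>' (a + s * (b - a))) (at s)" for s
  proof -
    have "((\<lambda>s. a + s * (b - a)) has_vector_derivative (b - a)) (at s)"
      by (auto intro!: derivative_eq_intros)
    from vector_diff_chain_at[OF this der] show ?thesis
      by (simp add: \<eta>_def[abs_def] o_def)
  qed
  have vd: "vector_derivative \<eta> (at s) = (b - a) *\<^sub>R \<gamma>' (a + s * (b - a))" for s
    using \<eta>' vector_derivative_at by blast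
  have "continuous_on {0..1} (\<lambda>s. (b - a) *\<^sub>R \<gamma>' (a + s * (b - a)))"
    by (intro continuous_intros continuous_on_compose2[OF cont]) auto
  then have "\<eta> C1_differentiable_on {0..1}"
    unfolding C1_differentiable_on_def
    by (intro exI[of _ "\<lambda>s. (b - a) *\<^sub>R \<gamma>' (a + s * (b - a))"] conjI ballI \<eta>')
  then have "valid_path \<eta>"
    by (simp add: valid_path_def C1_differentiable_imp_piecewise)
  moreover have "path_image \<eta> \<subseteq> upper_half_plane"
    using pos by (auto simp: path_image_def upper_half_plane_def \<eta>_def)
  moreover have "((\<lambda>t. norm (vector_derivative \<eta> (at t)) / Im (\<eta> t)) has_integral \<bar>b - a\<bar>) {0..1}"
  proof -
    have "norm (vector_derivative \<eta> (at t)) / Im (\<eta> t) = \<bar>b - a\<bar>" for t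
      using pos[of "a + t * (b - a)"] by (simp add: vd speed \<eta>_def)
    then show ?thesis
      using has_integral_const_real[of "\<bar>b - a\<bar>" 0 1] by simp
  qed
  moreover have "pathstart \<eta> = \<gamma> a" "pathfinish \<eta> = \<gamma> b"
    by (simp_all add: pathstart_def pathfinish_def \<eta>_def)
  ultimately show ?thesis
    unfolding hyp_path_lengths_def by blast
qed

lemma has_vector_derivative_Complex:
  assumes "(f has_real_derivative f') (at t)" "(g has_real_derivative g') (at t)"
  shows "((\<lambda>t. Complex (f t) (g t)) has_vector_derivative Complex f' g') (at t)"
  using assms by (simp add: has_vector_derivative_complex_iff)

lemma vertical_length:
  assumes "Re z = Re w" "Im z > 0" "Im w > 0"
  shows "\<bar>ln (Im w) - ln (Im z)\<bar> \<in> hyp_path_lengths z w"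
proof -
  define \<gamma> where "\<gamma> t = Complex (Re z) (exp t)" for t :: real
  have "\<bar>ln (Im w) - ln (Im z)\<bar> \<in> hyp_path_lengths (\<gamma> (ln (Im z))) (\<gamma> (ln (Im w)))"
  proof (rule unit_speed_length)
    show "(\<gamma> has_vector_derivative Complex 0 (exp t)) (at t)" for t
      unfolding \<gamma>_def by (rule has_vector_derivative_Complex) (auto intro!: derivative_eq_intros)
    show "continuous_on UNIV (\<lambda>t::real. Complex 0 (exp t))"
      unfolding Complex_eq by (intro continuous_intros)
  qed (auto simp: \<gamma>_def cmod_def)
  moreover have "\<gamma> (ln (Im z)) = z" "\<gamma> (ln (Im w)) = w"
    using assms by (simp_all add: \<gamma>_def complex_eq_iff)
  ultimately show ?thesis by simp
qed

text \<open>Links the arc parameter to the height, both to recover a point from its parameter and to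
  evaluate the \<open>cosh\<close> of a difference of parameters.\<close>

lemma cosh_arsinh_circle:
  assumes "(Re u - c)\<^sup>2 + (Im u)\<^sup>2 = R\<^sup>2" "Im u > 0" "R > 0"
  shows "cosh (arsinh ((Re u - c) / Im u)) = R / Im u"
proof -
  have "((Re u - c) / Im u)\<^sup>2 + 1 = (R / Im u)\<^sup>2"
    using assms(2) by (simp add: power_divide add_divide_distrib assms(1)[symmetric])
  then show ?thesis
    using assms by (simp add: cosh_arsinh_real del: power_divide)
qed

text \<open>In the coordinate \<open>t = arsinh ((x - c) / y)\<close> the semicircle with centre \<open>c\<close> and radius \<open>R\<close>
  is the unit-speed curve \<open>c + R tanh t + i R / cosh t\<close>.\<close>

lemma arc_length:
  assumes z: "(Re z - c)\<^sup>2 + (Im z)\<^sup>2 = R\<^sup>2" "Im z > 0"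
    and w: "(Re w - c)\<^sup>2 + (Im w)\<^sup>2 = R\<^sup>2" "Im w > 0" and R: "R > 0"
  shows "\<bar>arsinh ((Re w - c) / Im w) - arsinh ((Re z - c) / Im z)\<bar> \<in> hyp_path_lengths z w"
proof -
  define \<gamma> where "\<gamma> t = Complex (c + R * tanh t) (R / cosh t)" for t :: real
  have end_pt: "\<gamma> (arsinh ((Re u - c) / Im u)) = u"
    if u: "(Re u - c)\<^sup>2 + (Im u)\<^sup>2 = R\<^sup>2" "Im u > 0" for u
  proof -
    have "cosh (arsinh ((Re u - c) / Im u)) = R / Im u"
      by (rule cosh_arsinh_circle[OF u R])
    then show ?thesis
      using R u by (simp add: \<gamma>_def tanh_def complex_eq_iff)
  qed
  have "\<bar>arsinh ((Re w - c) / Im w) - arsinh ((Re z - c) / Im z)\<bar>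
     \<in> hyp_path_lengths (\<gamma> (arsinh ((Re z - c) / Im z))) (\<gamma> (arsinh ((Re w - c) / Im w)))"
  proof (rule unit_speed_length)
    define \<gamma>' where "\<gamma>' t = Complex (R / (cosh t)\<^sup>2) (- (R * sinh t / (cosh t)\<^sup>2))" for t :: real
    have cs: "(cosh t)\<^sup>2 = 1 + (sinh t)\<^sup>2" for t :: real
      by (simp add: cosh_square_eq)
    have sech: "1 - (tanh t)\<^sup>2 = 1 / (cosh t)\<^sup>2" for t :: real
    proof -
      have "1 + (sinh t)\<^sup>2 \<noteq> 0"
        using zero_le_power2[of "sinh t"] by linarith
      then show ?thesis
        by (simp add: tanh_def power_divide cs diff_divide_eq_iff)
    qed
    show "(\<gamma> has_vector_derivative \<gamma>' t) (at t)" for t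
      unfolding \<gamma>_def \<gamma>'_def
    proof (rule has_vector_derivative_Complex)
      show "((\<lambda>t. c + R * tanh t) has_real_derivative R / (cosh t)\<^sup>2) (at t)"
        by (auto intro!: derivative_eq_intros simp: sech[of t])
      show "((\<lambda>t. R / cosh t) has_real_derivative - (R * sinh t / (cosh t)\<^sup>2)) (at t)"
        by (auto intro!: derivative_eq_intros simp: power2_eq_square)
    qed
    show "continuous_on UNIV \<gamma>'"
      unfolding \<gamma>'_def Complex_eq by (intro continuous_intros) auto
    show "norm (\<gamma>' t) = Im (\<gamma> t)" for t
    proof -
      have "(R / (cosh t)\<^sup>2)\<^sup>2 + (R * sinh t / (cosh t)\<^sup>2)\<^sup>2 = R\<^sup>2 * (1 + (sinh t)\<^sup>2) / ((cosh t)\<^sup>2)\<^sup>2"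
        by (simp add: power_divide power_mult_distrib add_divide_distrib ring_distribs)
      also have "\<dots> = (R / cosh t)\<^sup>2"
        unfolding cs[symmetric] by (simp add: power_divide power2_eq_square)
      finally show ?thesis
        using R by (simp add: \<gamma>_def \<gamma>'_def cmod_def del: power_divide)
    qed
    show "0 < Im (\<gamma> t)" for t
      using R by (simp add: \<gamma>_def)
  qed
  then show ?thesis
    using z w by (simp add: end_pt)
qed

text \<open>The geodesic arc realises the classical \<open>cosh\<close> formula. Its minimality is
  not claimed: the arc bounds \<open>hyp_dist\<close> from above and shows that there are paths at
  all.\<close>

lemma ex_hyp_path_length:
  assumes z: "Im z > 0" and w: "Im w > 0"
  shows "\<exists>L\<in>hyp_path_lengths z w. cosh L = 1 + (cmod (z - w))\<^sup>2 / (2 * Im z * Im w)"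
proof (cases "Re z = Re w")
  case True
  have "cosh \<bar>ln (Im w) - ln (Im z)\<bar> = cosh (ln (Im w / Im z))"
    using z w by (simp add: ln_div)
  also have "\<dots> = (Im w / Im z + Im z / Im w) / 2"
    using z w by (simp add: cosh_ln_real)
  also have "\<dots> = 1 + (cmod (z - w))\<^sup>2 / (2 * Im z * Im w)"
    using z w True by (simp add: cmod_power2 divide_simps) (simp add: power2_eq_square algebra_simps)
  finally show ?thesis
    using vertical_length[OF True z w] by blast
next
  case False
  \<comment> \<open>The perpendicular bisector of \<open>z\<close> and \<open>w\<close> meets the
    real axis in \<open>c\<close>, the centre of the semicircle through both points.\<close>
  define c where "c = ((Re w)\<^sup>2 + (Im w)\<^sup>2 - (Re z)\<^sup>2 - (Im z)\<^sup>2) / (2 * (Re w - Re z))"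
  define R where "R = sqrt ((Re z - c)\<^sup>2 + (Im z)\<^sup>2)"
  have R: "R > 0" and zR: "(Re z - c)\<^sup>2 + (Im z)\<^sup>2 = R\<^sup>2"
    using z by (simp_all add: R_def sum_power2_gt_zero_iff)
  have "c * (2 * (Re w - Re z)) = (Re w)\<^sup>2 + (Im w)\<^sup>2 - (Re z)\<^sup>2 - (Im z)\<^sup>2"
    using False unfolding c_def by (intro nonzero_eq_divide_eq[THEN iffD1]) auto
  then have "(Re w - c)\<^sup>2 + (Im w)\<^sup>2 = (Re z - c)\<^sup>2 + (Im z)\<^sup>2"
    by (simp add: power2_eq_square algebra_simps)
  then have wR: "(Re w - c)\<^sup>2 + (Im w)\<^sup>2 = R\<^sup>2"
    using zR by simp
  have "cosh \<bar>arsinh ((Re w - c) / Im w) - arsinh ((Re z - c) / Im z)\<bar>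
     = (R\<^sup>2 - (Re w - c) * (Re z - c)) / (Im z * Im w)"
    unfolding cosh_real_abs cosh_diff cosh_arsinh_circle[OF zR z R] cosh_arsinh_circle[OF wR w R] sinh_arsinh_real
    using z w by (simp add: power2_eq_square divide_simps)
  also have "2 * (R\<^sup>2 - (Re w - c) * (Re z - c)) = 2 * Im z * Im w + (cmod (z - w))\<^sup>2"
    using zR wR by (simp add: cmod_power2) (simp add: power2_eq_square algebra_simps)
  then have "(R\<^sup>2 - (Re w - c) * (Re z - c)) / (Im z * Im w)
      = 1 + (cmod (z - w))\<^sup>2 / (2 * Im z * Im w)"
    using z w by (simp add: field_simps)
  finally show ?thesis
    using arc_length[OF zR z wR w R] by blast
qed

lemma hyp_dist_nonneg:
  assumes "Im z > 0" "Im w > 0"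
  shows "0 \<le> hyp_dist z w"
  unfolding hyp_dist_def
  using ex_hyp_path_length[OF assms] by (intro cInf_greatest hyp_path_lengths_nonneg) auto

section \<open>Lower bounds from the signed distance to a geodesic\<close>

text \<open>The geodesic whose end points are the zeros of \<open>A x\<^sup>2 + B x + C\<close> is the zero set of
  \<open>herm A B C z 1\<close>; the two-variable version makes substitutions by integer matrices linear.\<close>

definition herm :: "real \<Rightarrow> real \<Rightarrow> real \<Rightarrow> complex \<Rightarrow> complex \<Rightarrow> real" where
  "herm A B C u v = A * (cmod u)\<^sup>2 + B * Re (u * cnj v) + C * (cmod v)\<^sup>2"

text \<open>\<open>arsinh (N / (y \<surd>D))\<close> is the signed distance to the geodesic, hence 1-Lipschitz for the
  hyperbolic metric; this is the infinitesimal form, by Cauchy-Schwarz and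
  \<open>(2 A x + B)\<^sup>2 + (2 A y - N / y)\<^sup>2 = D + N\<^sup>2 / y\<^sup>2\<close>.\<close>

lemma gradient_bound:
  fixes A B C x y x' y' :: real
  defines "D \<equiv> B\<^sup>2 - 4 * A * C" and "N \<equiv> A * (x\<^sup>2 + y\<^sup>2) + B * x + C"
  assumes D: "D > 0" and y: "y > 0"
  shows "((2 * A * x + B) * x' / y + (2 * A * y\<^sup>2 - N) * y' / y\<^sup>2) / sqrt D
    / sqrt ((N / (y * sqrt D))\<^sup>2 + 1) \<le> sqrt (x'\<^sup>2 + y'\<^sup>2) / y"
proof -
  define p where "p = 2 * A * x + B"
  define q where "q = (2 * A * y\<^sup>2 - N) / y"
  have qy: "q * y = 2 * A * y\<^sup>2 - N"
    using y by (simp add: q_def)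
  have "y\<^sup>2 * (p\<^sup>2 + q\<^sup>2) = (p * y)\<^sup>2 + (q * y)\<^sup>2"
    by (simp add: power_mult_distrib algebra_simps)
  also have "\<dots> = N\<^sup>2 + D * y\<^sup>2"
    unfolding qy unfolding p_def D_def N_def by (simp add: power2_eq_square algebra_simps)
  finally have pq: "p\<^sup>2 + q\<^sup>2 = D * ((N / (y * sqrt D))\<^sup>2 + 1)"
    using y D by (simp add: power_divide power_mult_distrib field_simps)
  define E where "E = sqrt (p\<^sup>2 + q\<^sup>2)"
  have E: "E = sqrt D * sqrt ((N / (y * sqrt D))\<^sup>2 + 1)"
    unfolding E_def pq by (simp add: real_sqrt_mult)
  have Epos: "E > 0"
    unfolding E using D by (simp add: add_nonneg_pos)
  have "(p * x' + q * y')\<^sup>2 \<le> (p\<^sup>2 + q\<^sup>2) * (x'\<^sup>2 + y'\<^sup>2)"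
    using zero_le_power2[of "p * y' - q * x'"] by (simp add: power2_eq_square algebra_simps)
  then have cs: "p * x' + q * y' \<le> E * sqrt (x'\<^sup>2 + y'\<^sup>2)"
    unfolding E_def real_sqrt_mult[symmetric] by (rule real_le_rsqrt)
  have "(2 * A * x + B) * x' / y + (2 * A * y\<^sup>2 - N) * y' / y\<^sup>2 = (p * x' + q * y') / y"
    using y by (simp add: p_def q_def power2_eq_square add_divide_distrib)
  also have "\<dots> / sqrt D / sqrt ((N / (y * sqrt D))\<^sup>2 + 1) = (p * x' + q * y') / E / y"
    by (simp add: E)
  also have "\<dots> \<le> sqrt (x'\<^sup>2 + y'\<^sup>2) / y"
    using cs Epos y by (intro divide_right_mono) (simp_all add: pos_divide_le_eq mult.commute)
  finally show ?thesis .
qed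

lemma arsinh_diff_le_length:
  fixes A B C :: real
  defines "D \<equiv> B\<^sup>2 - 4 * A * C"
  assumes D: "D > 0" and L: "L \<in> hyp_path_lengths z w"
  shows "arsinh (herm A B C w 1 / (Im w * sqrt D)) - arsinh (herm A B C z 1 / (Im z * sqrt D)) \<le> L"
proof -
  obtain \<gamma> where vp: "valid_path \<gamma>" and im: "path_image \<gamma> \<subseteq> upper_half_plane"
    and ends: "pathstart \<gamma> = z" "pathfinish \<gamma> = w"
    and int: "((\<lambda>t. norm (vector_derivative \<gamma> (at t)) / Im (\<gamma> t)) has_integral L) {0..1}"
    using L unfolding hyp_path_lengths_def by blast
  obtain S where S: "finite S" "\<gamma> C1_differentiable_on ({0..1} - S)" and c: "continuous_on {0..1} \<gamma>"
    using vp unfolding valid_path_def piecewise_C1_differentiable_on_def by blast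
  have pos: "Im (\<gamma> t) > 0" if "t \<in> {0..1}" for t
  proof -
    have "\<gamma> t \<in> path_image \<gamma>"
      using that by (simp add: path_image_def)
    then show ?thesis
      using im by (auto simp: upper_half_plane_def)
  qed
  define X where "X t = Re (\<gamma> t)" for t
  define Y where "Y t = Im (\<gamma> t)" for t
  define N where "N t = A * ((X t)\<^sup>2 + (Y t)\<^sup>2) + B * X t + C" for t
  define X' where "X' t = Re (vector_derivative \<gamma> (at t))" for t
  define Y' where "Y' t = Im (vector_derivative \<gamma> (at t))" for t
  define \<phi> where "\<phi> t = arsinh (N t / (Y t * sqrt D))" for t
  define \<phi>' where "\<phi>' t = ((2 * A * X t + B) * X' t / Y t + (2 * A * (Y t)\<^sup>2 - N t) * Y' t / (Y t)\<^sup>2)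
     / sqrt D / sqrt ((N t / (Y t * sqrt D))\<^sup>2 + 1)" for t
  have N: "N t = herm A B C (\<gamma> t) 1" for t
    by (simp add: N_def herm_def X_def Y_def cmod_power2)
  have der: "(\<phi> has_vector_derivative \<phi>' t) (at t)" if t: "t \<in> {0..1} - S" for t
  proof -
    have "(\<gamma> has_vector_derivative vector_derivative \<gamma> (at t)) (at t)"
      using S(2) t C1_differentiable_on_eq vector_derivative_works by blast
    then have dX: "(X has_real_derivative X' t) (at t)" and dY: "(Y has_real_derivative Y' t) (at t)"
      unfolding has_vector_derivative_complex_iff X_def Y_def X'_def Y'_def by auto
    have Y0: "Y t > 0"
      using pos t by (simp add: Y_def)
    have dN: "(N has_real_derivative 2 * A * X t * X' t + 2 * A * Y t * Y' t + B * X' t) (at t)"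
      unfolding N_def using dX dY by (auto intro!: derivative_eq_intros simp: algebra_simps)
    have "((\<lambda>t. N t / (Y t * sqrt D)) has_real_derivative
      ((2 * A * X t * X' t + 2 * A * Y t * Y' t + B * X' t) * (Y t * sqrt D) - N t * (Y' t * sqrt D))
        / (Y t * sqrt D * (Y t * sqrt D))) (at t)"
      using dN dY Y0 D by (auto intro!: derivative_eq_intros)
    also have "((2 * A * X t * X' t + 2 * A * Y t * Y' t + B * X' t) * (Y t * sqrt D) - N t * (Y' t * sqrt D))
        / (Y t * sqrt D * (Y t * sqrt D))
       = ((2 * A * X t + B) * X' t / Y t + (2 * A * (Y t)\<^sup>2 - N t) * Y' t / (Y t)\<^sup>2) / sqrt D"
      using Y0 D by (simp add: divide_simps power2_eq_square) (simp add: algebra_simps)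
    finally have "(\<phi> has_real_derivative \<phi>' t) (at t)"
      using DERIV_chain2[OF arsinh_real_has_field_derivative] unfolding \<phi>_def \<phi>'_def by fastforce
    then show ?thesis
      by (simp add: has_real_derivative_iff_has_vector_derivative)
  qed
  have cont: "continuous_on {0..1} \<phi>"
    unfolding \<phi>_def N_def X_def Y_def using D pos by (fastforce intro!: continuous_intros c)
  \<comment> \<open>The finitely many break points do not affect the integral; the value 0 given to
    the derivative there stays below the nonnegative speed.\<close>
  have "((\<lambda>t. if t \<in> S then 0 else \<phi>' t) has_integral \<phi> 1 - \<phi> 0) {0..1}"
    by (rule fundamental_theorem_of_calculus_strong[OF S(1) _ _ cont]) (use der in auto)
  then have "\<phi> 1 - \<phi> 0 \<le> L"
  proof (rule has_integral_le[OF _ int])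
    fix t :: real assume t: "t \<in> {0..1}"
    have "\<phi>' t \<le> norm (vector_derivative \<gamma> (at t)) / Im (\<gamma> t)"
      using gradient_bound[of B A C "Y t" "X t" "X' t" "Y' t"] D pos[OF t]
      by (simp add: \<phi>'_def N_def D_def cmod_def X'_def Y'_def Y_def)
    then show "(if t \<in> S then 0 else \<phi>' t) \<le> norm (vector_derivative \<gamma> (at t)) / Im (\<gamma> t)"
      using pos[OF t] by auto
  qed
  moreover have "\<gamma> 0 = z" "\<gamma> 1 = w"
    using ends by (simp_all add: pathstart_def pathfinish_def)
  ultimately show ?thesis
    by (simp add: \<phi>_def N Y_def)
qed

lemma herm_uminus: "herm (- A) (- B) (- C) u v = - herm A B C u v"
  by (simp add: herm_def)

text \<open>The signed distance vanishes at \<open>w\<close>, so no path from \<open>z\<close> is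
  shorter than its absolute value at \<open>z\<close>. The form and its negative handle the two
  signs.\<close>

lemma arsinh_le_hyp_dist:
  fixes A B C :: real
  defines "D \<equiv> B\<^sup>2 - 4 * A * C"
  assumes D: "D > 0" and z: "Im z > 0" and w: "Im w > 0" and hw: "herm A B C w 1 = 0"
  shows "arsinh (\<bar>herm A B C z 1\<bar> / (Im z * sqrt D)) \<le> hyp_dist z w"
  unfolding hyp_dist_def
proof (rule cInf_greatest)
  show "hyp_path_lengths z w \<noteq> {}"
    using ex_hyp_path_length[OF z w] by blast
  fix L assume L: "L \<in> hyp_path_lengths z w"
  have "- arsinh (herm A B C z 1 / (Im z * sqrt D)) \<le> L"
    using arsinh_diff_le_length[of B A C L z w] L D hw by (simp add: D_def)
  moreover have "arsinh (herm A B C z 1 / (Im z * sqrt D)) \<le> L"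
    using arsinh_diff_le_length[of "- B" "- A" "- C" L z w] L D hw by (simp add: D_def herm_uminus)
  ultimately show "arsinh (\<bar>herm A B C z 1\<bar> / (Im z * sqrt D)) \<le> L"
    by (cases "herm A B C z 1 \<ge> 0") auto
qed

subsection \<open>Translates of geodesics\<close>

definition qform :: "real \<Rightarrow> real \<Rightarrow> real \<Rightarrow> int \<Rightarrow> int \<Rightarrow> real" where
  "qform A B C x y = A * (of_int x)\<^sup>2 + B * of_int x * of_int y + C * (of_int y)\<^sup>2"

text \<open>The polar form of \<open>qform\<close> at the columns \<open>(a, c)\<close> and
  \<open>(b, d)\<close>, which is the middle coefficient after substitution.\<close>

definition bform :: "real \<Rightarrow> real \<Rightarrow> real \<Rightarrow> int \<Rightarrow> int \<Rightarrow> int \<Rightarrow> int \<Rightarrow> real" where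
  "bform A B C a b c d = 2 * A * of_int (a * b) + B * of_int (a * d + b * c) + 2 * C * of_int (c * d)"

lemma herm_substitution:
  "herm A B C (of_int a * u + of_int b * v) (of_int c * u + of_int d * v) =
     herm (qform A B C a c) (bform A B C a b c d) (qform A B C b d) u v"
  by (simp add: herm_def qform_def bform_def cmod_power2) (simp add: power2_eq_square algebra_simps)

lemma discriminant_substitution:
  "(bform A B C a b c d)\<^sup>2 - 4 * qform A B C a c * qform A B C b d =
     (B\<^sup>2 - 4 * A * C) * (of_int (a * d - b * c))\<^sup>2"
  by (simp add: qform_def bform_def power2_eq_square algebra_simps)

text \<open>Homogeneity allows \<open>herm\<close> to be evaluated at numerator and denominator of a
  Moebius image, without dividing.\<close>

lemma herm_scale: "herm A B C (k * u) (k * v) = (cmod k)\<^sup>2 * herm A B C u v"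
proof -
  have "Re (k * u * cnj (k * v)) = (cmod k)\<^sup>2 * Re (u * cnj v)"
    by (simp add: cmod_power2) (simp add: power2_eq_square algebra_simps)
  then show ?thesis
    by (simp add: herm_def norm_mult power_mult_distrib algebra_simps)
qed

lemma herm_cnj: "herm A B C (cnj u) (cnj v) = herm A B C u v"
  by (simp add: herm_def)

section \<open>Every geodesic has a translate meeting the disc\<close>

text \<open>For determinant -1 the quotient of the two arguments lies in the lower half-plane; this
  is harmless because \<open>herm\<close> is invariant under conjugation.\<close>

definition meets_disc :: "real \<Rightarrow> real \<Rightarrow> real \<Rightarrow> bool" where
  "meets_disc A B C \<longleftrightarrow> (\<exists>a b c d :: int. \<exists>w. \<bar>a * d - b * c\<bar> = 1 \<and>
     cmod (w - Complex 0 (3/2)) \<le> 1/2 \<and> herm A B C (of_int a * w + of_int b) (of_int c * w + of_int d) = 0)"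

lemma meets_disc_uminus: "meets_disc (- A) (- B) (- C) = meets_disc A B C"
  by (simp add: meets_disc_def herm_uminus)

text \<open>Composed substitutions multiply their matrices and determinants, so a form may be
  replaced by an equivalent one.\<close>

lemma meets_disc_substitution:
  assumes det: "\<bar>a * d - b * c\<bar> = 1"
    and m: "meets_disc (qform A B C a c) (bform A B C a b c d) (qform A B C b d)"
  shows "meets_disc A B C"
proof -
  obtain a' b' c' d' w where det': "\<bar>a' * d' - b' * c'\<bar> = 1" and w: "cmod (w - Complex 0 (3/2)) \<le> 1/2"
    and h: "herm (qform A B C a c) (bform A B C a b c d) (qform A B C b d)
      (of_int a' * w + of_int b') (of_int c' * w + of_int d') = 0"
    using m unfolding meets_disc_def by blast
  have "(a * a' + b * c') * (c * b' + d * d') - (a * b' + b * d') * (c * a' + d * c')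
      = (a * d - b * c) * (a' * d' - b' * c')"
    by algebra
  then have "\<bar>(a * a' + b * c') * (c * b' + d * d') - (a * b' + b * d') * (c * a' + d * c')\<bar> = 1"
    by (simp add: abs_mult det det')
  moreover have "herm A B C (of_int (a * a' + b * c') * w + of_int (a * b' + b * d'))
      (of_int (c * a' + d * c') * w + of_int (c * b' + d * d')) = 0"
    using h unfolding herm_substitution[symmetric] by (simp add: algebra_simps)
  ultimately show ?thesis
    unfolding meets_disc_def using w by blast
qed

text \<open>The line \<open>Im z = 3/2\<close> is covered by the integer translates of the disc.\<close>

lemma meets_disc_height:
  assumes "A * (x\<^sup>2 + 9/4) + B * x + C = 0"
  shows "meets_disc A B C"
  unfolding meets_disc_def
proof (intro exI conjI)
  let ?n = "round x"
  let ?w = "Complex (x - of_int ?n) (3/2)"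
  show "\<bar>1 * 1 - ?n * 0\<bar> = 1" by simp
  have "?w - Complex 0 (3/2) = of_real (x - of_int ?n)"
    by (simp add: complex_eq_iff)
  then show "cmod (?w - Complex 0 (3/2)) \<le> 1/2"
    using of_int_round_abs_le[of x] by (metis abs_minus_commute norm_of_real real_norm_def)
  have "of_int 1 * ?w + of_int ?n = Complex x (3/2)"
    by (simp add: complex_eq_iff)
  then show "herm A B C (of_int 1 * ?w + of_int ?n) (of_int 0 * ?w + of_int 1) = 0"
    using assms by (simp add: herm_def cmod_power2 power_divide)
qed

lemma meets_disc_vertical:
  assumes "B \<noteq> 0"
  shows "meets_disc 0 B C"
  by (rule meets_disc_height[of _ "- C / B"]) (use assms in simp)

text \<open>The hypothesis says that the radius \<open>sqrt D / (2 \<bar>A\<bar>)\<close> is at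
  least 3/2; \<open>x\<close> is the abscissa of a crossing with the line of height 3/2.\<close>

lemma meets_disc_radius:
  assumes "A \<noteq> 0" "9 * A\<^sup>2 \<le> B\<^sup>2 - 4 * A * C"
  shows "meets_disc A B C"
proof -
  define s where "s = sqrt (B\<^sup>2 - 4 * A * C - 9 * A\<^sup>2)"
  have s: "s * s = B\<^sup>2 - 4 * A * C - 9 * A\<^sup>2"
    using assms by (simp add: s_def)
  define x where "x = (s - B) / (2 * A)"
  have x: "2 * A * x = s - B"
    using assms by (simp add: x_def)
  have "4 * A * (A * (x\<^sup>2 + 9/4) + B * x + C) = (2 * A * x + B)\<^sup>2 - B\<^sup>2 + 4 * A * C + 9 * A\<^sup>2"
    by (simp add: power2_eq_square algebra_simps)
  also have "\<dots> = 0"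
    unfolding x using s by (simp add: power2_eq_square)
  finally show ?thesis
    using assms(1) by (intro meets_disc_height) simp
qed

text \<open>The geodesic crosses the imaginary axis at height \<open>y = \<surd>(- C / A)\<close>: inside the disc if
  \<open>1 \<le> y \<le> 2\<close>, and above it only if the radius is large enough to reach height \<open>3/2\<close>.\<close>

lemma meets_disc_axis_ge:
  assumes A: "A > 0" and AC: "A \<le> - C"
  shows "meets_disc A B C"
proof (cases "- C \<le> 4 * A")
  case True
  define y where "y = sqrt (- C / A)"
  have y2: "A * y\<^sup>2 = - C"
  proof -
    have "y\<^sup>2 = - C / A"
      unfolding y_def using A AC by (intro real_sqrt_pow2 divide_nonneg_pos) auto
    then show ?thesis
      using A by simp
  qed
  have "1 \<le> - C / A" "- C / A \<le> 2\<^sup>2"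
    using A AC True by (simp_all add: field_simps)
  then have y: "1 \<le> y" "y \<le> 2"
    unfolding y_def by (auto intro: real_le_lsqrt)
  show ?thesis
    unfolding meets_disc_def
  proof (intro exI conjI)
    show "\<bar>1 * 1 - 0 * 0 :: int\<bar> = 1" by simp
    have "Complex 0 y - Complex 0 (3/2) = \<i> * of_real (y - 3/2)"
      by (simp add: complex_eq_iff)
    then have "cmod (Complex 0 y - Complex 0 (3/2)) = \<bar>y - 3/2\<bar>"
      by (simp only: norm_mult norm_ii norm_of_real mult_1)
    then show "cmod (Complex 0 y - Complex 0 (3/2)) \<le> 1/2"
      using y by linarith
    show "herm A B C (of_int 1 * Complex 0 y + of_int 0) (of_int 0 * Complex 0 y + of_int 1) = 0"
      using y2 by (simp add: herm_def cmod_power2)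
  qed
next
  case False
  have "A * (4 * A) \<le> A * (- C)"
    using A False by (intro mult_left_mono) auto
  moreover have "0 \<le> A\<^sup>2" "0 \<le> B\<^sup>2" by simp_all
  ultimately have "9 * A\<^sup>2 \<le> B\<^sup>2 - 4 * A * C"
    unfolding power2_eq_square by linarith
  then show ?thesis
    using A by (intro meets_disc_radius) auto
qed

text \<open>Reflection in the unit circle, \<open>1 / cnj z\<close>; it inverts the height at which
  the imaginary axis is crossed.\<close>

lemma meets_disc_swap:
  assumes "meets_disc C B A"
  shows "meets_disc A B C"
  by (rule meets_disc_substitution[of 0 0 1 1]) (use assms in \<open>simp_all add: qform_def bform_def\<close>)

text \<open>A crossing below i is reflected to one above i; the sign change makes the new leading
  coefficient positive. For \<open>C = 0\<close> the geodesic ends at 0 and its reflection is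
  vertical.\<close>

lemma meets_disc_axis:
  assumes A: "A > 0" and C: "C \<le> 0" and D: "B\<^sup>2 - 4 * A * C > 0"
  shows "meets_disc A B C"
proof (cases "A \<le> - C")
  case True
  then show ?thesis by (rule meets_disc_axis_ge[OF A])
next
  case False
  show ?thesis
  proof (cases "C = 0")
    case True
    then show ?thesis
      using D meets_disc_swap[OF meets_disc_vertical] by simp
  next
    case C0: False
    have "meets_disc (- C) (- B) (- A)"
      using False C C0 by (intro meets_disc_axis_ge) auto
    then show ?thesis
      by (simp add: meets_disc_uminus meets_disc_swap)
  qed
qed

text \<open>The form is negative between its two real roots, and some rational \<open>p/q\<close>
  lies there.\<close>

lemma ex_qform_nonpos:
  assumes A: "A > 0" and D: "B\<^sup>2 - 4 * A * C > 0"
  shows "\<exists>p q. q > 0 \<and> qform A B C p q \<le> 0"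
proof -
  define s where "s = sqrt (B\<^sup>2 - 4 * A * C)"
  have s: "s > 0" "s * s = B\<^sup>2 - 4 * A * C"
    using D by (simp_all add: s_def)
  have "(- B - s) / (2 * A) < (- B + s) / (2 * A)"
    using A s by (intro divide_strict_right_mono) auto
  then obtain r where r: "r \<in> \<rat>" "(- B - s) / (2 * A) < r" "r < (- B + s) / (2 * A)"
    using Rats_dense_in_real by blast
  obtain p q where pq: "q > 0" "r = of_int p / of_int q"
    using r(1) by (elim Rats_cases')
  have "- s < 2 * A * r + B" "2 * A * r + B < s"
    using A r(2,3) by (simp_all add: field_simps)
  then have "(2 * A * r + B)\<^sup>2 < s\<^sup>2"
    using s by (intro power2_strict_mono) auto
  then have "4 * A * (A * r\<^sup>2 + B * r + C) < 0"
    using s by (simp add: power2_eq_square algebra_simps)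
  then have "A * r\<^sup>2 + B * r + C < 0"
    using A by (simp add: mult_less_0_iff)
  moreover have "qform A B C p q = (of_int q)\<^sup>2 * (A * r\<^sup>2 + B * r + C)"
    using pq by (simp add: qform_def power2_eq_square field_simps)
  ultimately have "qform A B C p q \<le> 0"
    by (simp add: mult_nonneg_nonpos)
  then show ?thesis
    using pq by blast
qed

text \<open>Choosing the smallest denominator \<open>q\<close> at which the form is nonpositive makes the form
  positive at a Farey neighbour of \<open>p/q\<close>, so that an equivalent form has outer coefficients of
  opposite sign: every geodesic has a translate crossing the imaginary axis.\<close>

lemma meets_disc_pos:
  assumes A: "A > 0" and D: "B\<^sup>2 - 4 * A * C > 0"
  shows "meets_disc A B C"
proof -
  define P where "P n \<longleftrightarrow> n > 0 \<and> (\<exists>p. qform A B C p (int n) \<le> 0)" for n :: nat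
  obtain p0 q0 where q0: "q0 > 0" "qform A B C p0 q0 \<le> 0"
    using ex_qform_nonpos[OF A D] by blast
  then have "P (nat q0)"
    by (auto simp: P_def)
  define n where "n = (LEAST n. P n)"
  have Pn: "P n" and least: "\<And>m. P m \<Longrightarrow> n \<le> m"
    unfolding n_def using \<open>P (nat q0)\<close> by (auto intro: LeastI Least_le)
  define q where "q = int n"
  obtain p where q: "q > 0" and p: "qform A B C p q \<le> 0"
    using Pn by (auto simp: P_def q_def)
  have pos: "qform A B C r s > 0" if "0 < s" "s < q" for r s
  proof (rule ccontr)
    assume "\<not> qform A B C r s > 0"
    then have "P (nat s)"
      using that by (auto simp: P_def not_less)
    then show False
      using least[of "nat s"] that by (simp add: q_def)
  qed
  \<comment> \<open>Cancelling a common factor would keep the form nonpositive at a smaller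
    denominator.\<close>
  have cop: "coprime p q"
  proof (rule ccontr)
    assume nc: "\<not> coprime p q"
    define g where "g = gcd p q"
    have g: "g > 1"
    proof -
      have "gcd p q > 0" "gcd p q \<noteq> 1"
        using q nc by (simp_all add: coprime_iff_gcd_eq_1)
      then show ?thesis
        unfolding g_def by linarith
    qed
    obtain p' q' where pq': "p = g * p'" "q = g * q'"
      using gcd_dvd1[of p q] gcd_dvd2[of p q] unfolding g_def dvd_def by blast
    have q': "q' > 0" "q' < q"
      using g q pq' by (simp_all add: zero_less_mult_iff)
    have "qform A B C p q = (of_int g)\<^sup>2 * qform A B C p' q'"
      unfolding pq' by (simp add: qform_def power2_eq_square algebra_simps)
    moreover have "(of_int g :: real)\<^sup>2 > 0"
      using g by simp
    ultimately show False
      using p pos[OF q', of p'] by (simp add: mult_le_0_iff)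
  qed
  obtain s0 r0 where "s0 * p + r0 * q = gcd p q"
    using bezout_int by blast
  then have s0: "p * s0 + q * r0 = 1"
    using cop by (simp add: coprime_iff_gcd_eq_1 mult.commute)
  \<comment> \<open>Reducing the Bezout coefficient modulo \<open>q\<close> keeps the determinant 1
    and puts the denominator of the neighbour below \<open>q\<close>.\<close>
  define s where "s = s0 mod q"
  define r where "r = - r0 - p * (s0 div q)"
  have "s = s0 - q * (s0 div q)"
    by (simp add: s_def minus_mult_div_eq_mod)
  then have det: "p * s - q * r = 1"
    using s0 unfolding r_def by algebra
  have s: "0 \<le> s" "s < q"
    using q by (simp_all add: s_def)
  \<comment> \<open>Denominator 0 is the neighbour at infinity, where the form has the sign of
    \<open>A\<close>; otherwise minimality of \<open>q\<close> applies.\<close>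
  have rs: "qform A B C r s > 0"
  proof (cases "s = 0")
    case True
    then have "r \<noteq> 0"
      using det by auto
    then show ?thesis
      using A True by (simp add: qform_def)
  qed (use s pos in auto)
  have det': "\<bar>r * q - p * s\<bar> = 1"
    using det by (simp add: algebra_simps)
  then have "(of_int (r * q - p * s) :: real)\<^sup>2 = 1"
    by (metis of_int_abs of_int_1 power2_abs one_power2)
  then have "(bform A B C r p s q)\<^sup>2 - 4 * qform A B C r s * qform A B C p q > 0"
    using D by (simp add: discriminant_substitution)
  then show ?thesis
    by (rule meets_disc_substitution[OF det' meets_disc_axis[OF rs p]])
qed

lemma meets_disc:
  assumes "B\<^sup>2 - 4 * A * C > 0"
  shows "meets_disc A B C"
proof (cases "A = 0")
  case True
  then show ?thesis using assms by (simp add: meets_disc_vertical)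
next
  case False
  then consider "A > 0" | "- A > 0" by linarith
  then show ?thesis
  proof cases
    case 1
    then show ?thesis using assms by (rule meets_disc_pos)
  next
    case 2
    then have "meets_disc (- A) (- B) (- C)"
      using assms by (intro meets_disc_pos) auto
    then show ?thesis by (simp add: meets_disc_uminus)
  qed
qed

subsection \<open>Distance from billiards to the base point\<close>

definition geo :: "real \<Rightarrow> real \<Rightarrow> real \<Rightarrow> complex set" where
  "geo A B C = {z. Im z > 0 \<and> herm A B C z 1 = 0}"

lemma denominator_nonzero:
  assumes "\<bar>a * d - b * c :: int\<bar> = 1" "Im w \<noteq> 0"
  shows "of_int c * w + of_int d \<noteq> 0"
proof
  assume h: "of_int c * w + of_int d = 0"
  then have "c = 0"
    using assms(2) by (auto simp: complex_eq_iff)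
  then show False
    using h assms(1) by auto
qed

text \<open>The equation puts \<open>v = (a w + b) / (c w + d)\<close> on the zero set, and the
  adjugate \<open>M\<close> sends it back to \<open>w\<close>. For determinant -1, \<open>v\<close>
  lies in the lower half-plane and \<open>cnj v\<close> takes its place.\<close>

lemma ex_matrix_action:
  assumes det: "\<bar>a * d - b * c\<bar> = 1" and w: "Im w > 0"
    and h: "herm A B C (of_int a * w + of_int b) (of_int c * w + of_int d) = 0"
  shows "\<exists>M z. (det M = 1 \<or> det M = -1) \<and> z \<in> geo A B C \<and> w = matrix_action M z"
proof -
  define k where "k = of_int c * w + of_int d"
  define v where "v = (of_int a * w + of_int b) / k"
  define M :: "int^2^2" where "M = vector [vector [d, - b], vector [- c, a]]"
  have k: "k \<noteq> 0"
    unfolding k_def using denominator_nonzero[OF det] w by simp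
  have kv: "k * v = of_int a * w + of_int b"
    using k by (simp add: v_def)
  have "(cmod k)\<^sup>2 * herm A B C v 1 = herm A B C (k * v) (k * 1)"
    by (rule herm_scale[symmetric])
  also have "\<dots> = 0"
    unfolding kv using h by (simp add: k_def)
  finally have hv: "herm A B C v 1 = 0"
    using k by simp
  have num: "of_int d * (of_int a * w + of_int b) - of_int b * k = of_int (a * d - b * c) * w"
    by (simp add: k_def algebra_simps)
  have den: "of_int a * k - of_int c * (of_int a * w + of_int b) = of_int (a * d - b * c)"
    by (simp add: k_def algebra_simps)
  have ne: "(of_int (a * d - b * c) :: complex) \<noteq> 0"
    unfolding of_int_eq_0_iff using det by auto
  have "(of_int d * v - of_int b) / (of_int a - of_int c * v)
      = (k * (of_int d * v - of_int b)) / (k * (of_int a - of_int c * v))"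
    using k by simp
  also have "\<dots> = (of_int d * (k * v) - of_int b * k) / (of_int a * k - of_int c * (k * v))"
    by (simp add: algebra_simps)
  also have "\<dots> = w"
    unfolding kv num den using ne by (rule nonzero_mult_div_cancel_left)
  finally have quot: "(of_int d * v - of_int b) / (of_int a - of_int c * v) = w" .
  have "Im v = Im ((of_int a * w + of_int b) * cnj k) / (cmod k)\<^sup>2"
    by (simp add: v_def Im_divide cmod_power2)
  also have "Im ((of_int a * w + of_int b) * cnj k) = of_int (a * d - b * c) * Im w"
    by (simp add: k_def algebra_simps)
  finally have Imv: "Im v = of_int (a * d - b * c) * Im w / (cmod k)\<^sup>2" .
  have detM: "det M = a * d - b * c"
    by (simp add: M_def det_2 algebra_simps)
  consider "a * d - b * c = 1" | "a * d - b * c = - 1"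
    using det by linarith
  then show ?thesis
  proof cases
    case 1
    have "v \<in> geo A B C"
      using Imv hv w k 1 by (simp add: geo_def)
    moreover have "w = matrix_action M v"
      using quot 1 detM by (simp add: matrix_action_def M_def)
    ultimately show ?thesis
      using detM 1 by auto
  next
    case 2
    have "Im v < 0"
      using Imv w k 2 by (simp add: divide_neg_pos)
    then have "cnj v \<in> geo A B C"
      using hv herm_cnj[of A B C v 1] by (simp add: geo_def)
    moreover have "w = matrix_action M (cnj v)"
      using quot 2 detM by (simp add: matrix_action_def M_def)
    ultimately show ?thesis
      using detM 2 by auto
  qed
qed

text \<open>Converse of \<open>ex_matrix_action\<close>: the entries of the adjugate of
  \<open>M\<close> are the witnesses.\<close>

lemma matrix_action_herm:
  assumes det: "det M = 1 \<or> det M = -1" and z: "z \<in> geo A B C"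
  shows "\<exists>a b c d :: int. \<bar>a * d - b * c\<bar> = 1 \<and>
    herm A B C (of_int a * matrix_action M z + of_int b) (of_int c * matrix_action M z + of_int d) = 0"
proof (intro exI conjI)
  define a b c d where "a = M$1$1" and "b = M$1$2" and "c = M$2$1" and "d = M$2$2"
  have detM: "det M = a * d - b * c"
    by (simp add: det_2 a_def b_def c_def d_def)
  show D: "\<bar>M$2$2 * M$1$1 - (- M$1$2) * (- M$2$1)\<bar> = 1"
    using det by (auto simp: det_2 algebra_simps)
  define u where "u = (if det M = 1 then z else cnj z)"
  define w where "w = matrix_action M z"
  define k where "k = of_int c * u + of_int d"
  have D': "\<bar>a * d - b * c\<bar> = 1"
    using det detM by auto
  have "Im u \<noteq> 0"
    using z by (auto simp: u_def geo_def)
  then have k: "k \<noteq> 0"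
    unfolding k_def by (rule denominator_nonzero[OF D'])
  have kw: "k * w = of_int a * u + of_int b"
    using k unfolding w_def matrix_action_def k_def u_def a_def b_def c_def d_def by (simp add: Let_def)
  have "k * (of_int d * w + of_int (- b)) = of_int d * (k * w) - of_int b * k"
    by (simp add: algebra_simps)
  also have "\<dots> = of_int (a * d - b * c) * u"
    unfolding kw by (simp add: k_def algebra_simps)
  finally have 1: "k * (of_int d * w + of_int (- b)) = of_int (a * d - b * c) * u" .
  have "k * (of_int (- c) * w + of_int a) = of_int a * k - of_int c * (k * w)"
    by (simp add: algebra_simps)
  also have "\<dots> = of_int (a * d - b * c) * 1"
    unfolding kw by (simp add: k_def algebra_simps)
  finally have 2: "k * (of_int (- c) * w + of_int a) = of_int (a * d - b * c) * 1" .
  have "(cmod k)\<^sup>2 * herm A B C (of_int d * w + of_int (- b)) (of_int (- c) * w + of_int a)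
     = (cmod (of_int (a * d - b * c)))\<^sup>2 * herm A B C u 1"
    unfolding herm_scale[symmetric] 1 2 ..
  moreover have "herm A B C u 1 = 0"
    using z herm_cnj[of A B C z 1] by (simp add: u_def geo_def)
  ultimately have "herm A B C (of_int d * w + of_int (- b)) (of_int (- c) * w + of_int a) = 0"
    using k by simp
  then show "herm A B C (of_int (M$2$2) * matrix_action M z + of_int (- M$1$2))
      (of_int (- M$2$1) * matrix_action M z + of_int (M$1$1)) = 0"
    by (simp add: w_def a_def b_def c_def d_def)
qed

text \<open>Reduces billiards to integer substitutions in one form. The diagonal pairs ensure that a
  point survives restriction to the triangle even if its translate touches the triangle nowhere
  else.\<close>

lemma billiard_points_eq:
  assumes F: "Field S = geo A B C" and I: "Id_on (geo A B C) \<subseteq> S"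
  shows "billiard_points (billiard S) = {w \<in> fundamental_triangle. \<exists>a b c d :: int.
    \<bar>a * d - b * c\<bar> = 1 \<and> herm A B C (of_int a * w + of_int b) (of_int c * w + of_int d) = 0}"
    (is "_ = ?R")
proof (intro equalityI subsetI)
  fix w assume "w \<in> billiard_points (billiard S)"
  then obtain g where g: "g \<in> PGL2Z"
    and w: "w \<in> Field (Restr (curve_image g S) fundamental_triangle)"
    by (auto simp: billiard_points_def billiard_def)
  then have "w \<in> fundamental_triangle" "w \<in> g ` Field S"
    by (force simp: Field_def curve_image_def)+
  then show "w \<in> ?R"
    using g matrix_action_herm F by (force simp: PGL2Z_def)
next
  fix w assume w: "w \<in> ?R"
  then have "Im w > 0"
    by (simp add: fundamental_triangle_def upper_half_plane_def)
  then obtain M z where M: "det M = 1 \<or> det M = -1" "z \<in> geo A B C" "w = matrix_action M z"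
    using w ex_matrix_action by blast
  have "(z, z) \<in> S"
    using I M by auto
  then have "(w, w) \<in> curve_image (matrix_action M) S"
    unfolding curve_image_def M(3) by force
  then have ww: "(w, w) \<in> Restr (curve_image (matrix_action M) S) fundamental_triangle"
    using w by simp
  have "matrix_action M \<in> PGL2Z"
    using M by (auto simp: PGL2Z_def)
  then have "Restr (curve_image (matrix_action M) S) fundamental_triangle \<in> billiard S"
    using ww unfolding billiard_def by blast
  then show "w \<in> billiard_points (billiard S)"
    using ww unfolding billiard_points_def by (blast intro: FieldI1)
qed

text \<open>The factor 2 gives \<open>C_half\<close> the integral form \<open>0, 2, -1\<close> of
  discriminant 4.\<close>

lemma vertical_geodesic:
  "Field (oriented_geodesic (Finite a) Infinity) = geo 0 2 (- 2 * a)"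
  "Id_on (geo 0 2 (- 2 * a)) \<subseteq> oriented_geodesic (Finite a) Infinity"
  "Field (oriented_geodesic Infinity (Finite a)) = geo 0 2 (- 2 * a)"
  "Id_on (geo 0 2 (- 2 * a)) \<subseteq> oriented_geodesic Infinity (Finite a)"
  by (auto simp: Field_def geo_def herm_def upper_half_plane_def)

text \<open>The coefficients are those of \<open>(x - a) * (x - b)\<close>.\<close>

lemma circular_geodesic:
  "Field (oriented_geodesic (Finite a) (Finite b)) = geo 1 (- (a + b)) (a * b)"
  "Id_on (geo 1 (- (a + b)) (a * b)) \<subseteq> oriented_geodesic (Finite a) (Finite b)"
proof -
  have *: "dist z (of_real ((a + b) / 2)) = \<bar>b - a\<bar> / 2 \<longleftrightarrow> herm 1 (- (a + b)) (a * b) z 1 = 0" for z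
  proof -
    have "dist z (of_real ((a + b) / 2)) = \<bar>b - a\<bar> / 2 \<longleftrightarrow>
        (dist z (of_real ((a + b) / 2)))\<^sup>2 = (\<bar>b - a\<bar> / 2)\<^sup>2"
      by (intro power2_eq_iff_nonneg[symmetric]) auto
    also have "\<dots> \<longleftrightarrow> (Re z - (a + b) / 2)\<^sup>2 + (Im z)\<^sup>2 = ((b - a) / 2)\<^sup>2"
      by (simp add: dist_norm cmod_power2 power_divide)
    also have "\<dots> \<longleftrightarrow> herm 1 (- (a + b)) (a * b) z 1 = 0"
    proof -
      have "(Re z - (a + b) / 2)\<^sup>2 + (Im z)\<^sup>2 - ((b - a) / 2)\<^sup>2 = herm 1 (- (a + b)) (a * b) z 1"
        by (simp add: herm_def cmod_power2) (simp add: power2_eq_square field_simps)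
      then show ?thesis
        by linarith
    qed
    finally show ?thesis .
  qed
  show "Field (oriented_geodesic (Finite a) (Finite b)) = geo 1 (- (a + b)) (a * b)"
    "Id_on (geo 1 (- (a + b)) (a * b)) \<subseteq> oriented_geodesic (Finite a) (Finite b)"
    unfolding oriented_geodesic.simps * by (auto simp: Field_def geo_def upper_half_plane_def)
qed

lemma ex_geodesic_form:
  assumes "\<alpha> \<noteq> \<beta>"
  shows "\<exists>A B C. B\<^sup>2 - 4 * A * C > 0 \<and> Field (oriented_geodesic \<alpha> \<beta>) = geo A B C \<and>
    Id_on (geo A B C) \<subseteq> oriented_geodesic \<alpha> \<beta>"
proof (cases \<alpha>; cases \<beta>)
  fix a b assume ab: "\<alpha> = Finite a" "\<beta> = Finite b"
  have "(- (a + b))\<^sup>2 - 4 * 1 * (a * b) = (a - b)\<^sup>2"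
    by (simp add: power2_eq_square algebra_simps)
  also have "\<dots> > 0"
    using assms ab by simp
  finally show ?thesis
    using circular_geodesic ab by blast
next
  fix a assume "\<alpha> = Finite a" "\<beta> = Infinity"
  then show ?thesis
    using vertical_geodesic(1,2)[of a] by (intro exI[of _ 0] exI[of _ 2] exI[of _ "- 2 * a"]) simp
next
  fix b assume "\<alpha> = Infinity" "\<beta> = Finite b"
  then show ?thesis
    using vertical_geodesic(3,4)[of b] by (intro exI[of _ 0] exI[of _ 2] exI[of _ "- 2 * b"]) simp
qed (use assms in auto)

section \<open>The disc around the base point\<close>

lemma disc_coordinates:
  assumes "cmod (w - Complex 0 (3/2)) \<le> 1/2"
  shows "1 \<le> Im w" "\<bar>Re w\<bar> \<le> 1/2" "1 \<le> cmod w"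
    "(Re w)\<^sup>2 + (Im w)\<^sup>2 + 2 \<le> 3 * Im w"
proof -
  show "1 \<le> Im w"
    using abs_Im_le_cmod[of "w - Complex 0 (3/2)"] assms by simp
  show "\<bar>Re w\<bar> \<le> 1/2"
    using abs_Re_le_cmod[of "w - Complex 0 (3/2)"] assms by simp
  show "1 \<le> cmod w"
    using \<open>1 \<le> Im w\<close> abs_Im_le_cmod[of w] by linarith
  have "(cmod (w - Complex 0 (3/2)))\<^sup>2 \<le> (1/2)\<^sup>2"
    using assms by (intro power_mono) auto
  then show "(Re w)\<^sup>2 + (Im w)\<^sup>2 + 2 \<le> 3 * Im w"
    by (simp add: cmod_power2) (simp add: power2_eq_square field_simps)
qed

lemma half_disc_in_triangle:
  assumes "cmod (w - Complex 0 (3/2)) \<le> 1/2" "0 \<le> Re w"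
  shows "w \<in> fundamental_triangle"
  using disc_coordinates[OF assms(1)] assms(2)
  by (simp add: fundamental_triangle_def upper_half_plane_def)

abbreviation z0 :: complex where "z0 \<equiv> \<i> * of_real (sqrt 2)"

lemma arsinh_mono: "x \<le> y \<Longrightarrow> arsinh x \<le> arsinh (y :: real)"
  by (metis arsinh_less_iff_real not_less)

text \<open>The Euclidean disc with centre \<open>3i/2\<close> and radius \<open>1/2\<close> is the hyperbolic disc around
  \<open>i\<surd>2\<close> of radius \<open>arsinh (1 / \<surd>8)\<close>.\<close>

lemma cosh_disc_radius: "cosh (arsinh (1 / sqrt 8)) = 3 / (2 * sqrt 2)"
proof -
  have "(1 / sqrt 8)\<^sup>2 + 1 = (3 / (2 * sqrt 2))\<^sup>2"
    by (simp add: power_divide power_mult_distrib)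
  then show ?thesis
    by (simp add: cosh_arsinh_real del: power_divide)
qed

text \<open>The right-hand side equals \<open>3 / (2 * sqrt 2)\<close> exactly on the circle
  bounding the disc.\<close>

lemma ex_disc_length:
  assumes "Im w > 0"
  shows "\<exists>L\<in>hyp_path_lengths z0 w. 0 \<le> L \<and>
    cosh L = ((Re w)\<^sup>2 + (Im w)\<^sup>2 + 2) / (2 * sqrt 2 * Im w)"
proof -
  obtain L where L: "L \<in> hyp_path_lengths z0 w"
    and cL: "cosh L = 1 + (cmod (z0 - w))\<^sup>2 / (2 * Im z0 * Im w)"
    using ex_hyp_path_length[of z0 w] assms by auto
  have "(cmod (z0 - w))\<^sup>2 = (Re w)\<^sup>2 + (sqrt 2 - Im w)\<^sup>2"
    by (simp add: cmod_power2)
  also have "\<dots> = (Re w)\<^sup>2 + (Im w)\<^sup>2 + 2 - 2 * sqrt 2 * Im w"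
    by (simp add: power2_diff)
  finally have "cosh L = ((Re w)\<^sup>2 + (Im w)\<^sup>2 + 2) / (2 * sqrt 2 * Im w)"
    using assms by (simp add: cL field_simps)
  then show ?thesis
    using L hyp_path_lengths_nonneg by blast
qed

lemma hyp_dist_disc_le:
  assumes "cmod (w - Complex 0 (3/2)) \<le> 1/2"
  shows "hyp_dist z0 w \<le> arsinh (1 / sqrt 8)"
proof -
  note w = disc_coordinates[OF assms]
  obtain L where L: "L \<in> hyp_path_lengths z0 w" "0 \<le> L"
    and cL: "cosh L = ((Re w)\<^sup>2 + (Im w)\<^sup>2 + 2) / (2 * sqrt 2 * Im w)"
    using ex_disc_length[of w] w by auto
  have "cosh L \<le> (3 * Im w) / (2 * sqrt 2 * Im w)"
    unfolding cL using w by (intro divide_right_mono) auto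
  also have "\<dots> = cosh (arsinh (1 / sqrt 8))"
    using w by (simp add: cosh_disc_radius)
  finally have "L \<le> arsinh (1 / sqrt 8)"
    using L by (subst (asm) cosh_real_nonneg_le_iff) (auto simp: less_imp_le)
  then show ?thesis
    using hyp_dist_le_length[OF L(1)] by linarith
qed

lemma hyp_dist_disc_less:
  assumes w: "Im w > 0" and disc: "(Re w)\<^sup>2 + (Im w)\<^sup>2 + 2 < 3 * Im w"
  shows "hyp_dist z0 w < arsinh (1 / sqrt 8)"
proof -
  obtain L where L: "L \<in> hyp_path_lengths z0 w" "0 \<le> L"
    and cL: "cosh L = ((Re w)\<^sup>2 + (Im w)\<^sup>2 + 2) / (2 * sqrt 2 * Im w)"
    using ex_disc_length[of w] w by auto
  have "cosh L < (3 * Im w) / (2 * sqrt 2 * Im w)"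
    unfolding cL using w disc by (intro divide_strict_right_mono) auto
  also have "\<dots> = cosh (arsinh (1 / sqrt 8))"
    using w by (simp add: cosh_disc_radius)
  finally have "L < arsinh (1 / sqrt 8)"
    using L by (subst (asm) cosh_real_nonneg_less_iff) (auto simp: less_imp_le)
  then show ?thesis
    using hyp_dist_le_length[OF L(1)] by linarith
qed

lemma triangle_Im_pos: "w \<in> fundamental_triangle \<Longrightarrow> Im w > 0"
  by (simp add: fundamental_triangle_def upper_half_plane_def)

lemma billiard_points_triangle: "w \<in> billiard_points (billiard S) \<Longrightarrow> w \<in> fundamental_triangle"
  by (auto simp: billiard_points_def billiard_def Field_def)

lemma billiard_dist_le:
  assumes "w \<in> billiard_points (billiard S)"
  shows "billiard_dist z0 (billiard S) \<le> hyp_dist z0 w"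
  unfolding billiard_dist_def
proof (rule cINF_lower[OF _ assms])
  show "bdd_below (hyp_dist z0 ` billiard_points (billiard S))"
    by (intro bdd_belowI2[of _ 0] hyp_dist_nonneg)
      (auto dest: billiard_points_triangle triangle_Im_pos)
qed

section \<open>Two-sided bounds for the distance of a billiard\<close>

context
  fixes S :: "complex rel" and A B C :: real
  assumes D: "B\<^sup>2 - 4 * A * C > 0" and F: "Field S = geo A B C" and I: "Id_on (geo A B C) \<subseteq> S"
begin

lemma ex_billiard_point_disc:
  "\<exists>w\<in>billiard_points (billiard S). cmod (w - Complex 0 (3/2)) \<le> 1/2"
proof -
  obtain a b c d w where det: "\<bar>a * d - b * c\<bar> = 1" and w: "cmod (w - Complex 0 (3/2)) \<le> 1/2"
    and h: "herm A B C (of_int a * w + of_int b) (of_int c * w + of_int d) = 0"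
    using meets_disc[OF D] unfolding meets_disc_def by blast
  show ?thesis
  proof (cases "0 \<le> Re w")
    case True
    then show ?thesis
      unfolding billiard_points_eq[OF F I] using det w h half_disc_in_triangle by blast
  next
    case False
    \<comment> \<open>Reflection in the imaginary axis preserves the disc; negating \<open>a\<close>
      and \<open>c\<close> turns both arguments into their conjugates.\<close>
    let ?w = "- cnj w"
    have "cmod (?w - Complex 0 (3/2)) = cmod (w - Complex 0 (3/2))"
      by (simp add: cmod_def)
    then have w': "cmod (?w - Complex 0 (3/2)) \<le> 1/2"
      using w by simp
    have "herm A B C (of_int (- a) * ?w + of_int b) (of_int (- c) * ?w + of_int d)
       = herm A B C (cnj (of_int a * w + of_int b)) (cnj (of_int c * w + of_int d))"
      by simp
    then have h': "herm A B C (of_int (- a) * ?w + of_int b) (of_int (- c) * ?w + of_int d) = 0"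
      using h by (simp only: herm_cnj)
    have det': "\<bar>(- a) * d - b * (- c)\<bar> = 1"
      using det by linarith
    have "?w \<in> fundamental_triangle"
      using w' False by (intro half_disc_in_triangle) auto
    then show ?thesis
      unfolding billiard_points_eq[OF F I] using det' w' h' by blast
  qed
qed

lemma billiard_dist_bounds:
  "0 \<le> billiard_dist z0 (billiard S)" "billiard_dist z0 (billiard S) \<le> arsinh (1 / sqrt 8)"
proof -
  obtain w where w: "w \<in> billiard_points (billiard S)" "cmod (w - Complex 0 (3/2)) \<le> 1/2"
    using ex_billiard_point_disc by blast
  show "0 \<le> billiard_dist z0 (billiard S)"
    unfolding billiard_dist_def using w
    by (intro cINF_greatest hyp_dist_nonneg) (auto dest: billiard_points_triangle triangle_Im_pos)
  show "billiard_dist z0 (billiard S) \<le> arsinh (1 / sqrt 8)"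
    using billiard_dist_le[OF w(1)] hyp_dist_disc_le[OF w(2)] by linarith
qed

text \<open>Turns the distance into arithmetic: \<open>z0\<close> has real part 0 and squared
  modulus 2, so an equivalent form takes the value \<open>2 * A' + C'\<close> there, while the
  discriminant is unchanged.\<close>

lemma billiard_dist_ge:
  assumes m: "\<And>a b c d. \<bar>a * d - b * c\<bar> = 1 \<Longrightarrow> m \<le> \<bar>2 * qform A B C a c + qform A B C b d\<bar>"
  shows "arsinh (m / (sqrt 2 * sqrt (B\<^sup>2 - 4 * A * C))) \<le> billiard_dist z0 (billiard S)"
  unfolding billiard_dist_def
proof (rule cINF_greatest)
  show "billiard_points (billiard S) \<noteq> {}"
    using ex_billiard_point_disc by blast
  fix w assume "w \<in> billiard_points (billiard S)"
  then obtain a b c d where w: "w \<in> fundamental_triangle" and det: "\<bar>a * d - b * c\<bar> = 1"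
    and h: "herm A B C (of_int a * w + of_int b) (of_int c * w + of_int d) = 0"
    unfolding billiard_points_eq[OF F I] by blast
  define A' B' C' where "A' = qform A B C a c" and "B' = bform A B C a b c d" and "C' = qform A B C b d"
  have h': "herm A' B' C' w 1 = 0"
    using h herm_substitution[of A B C a w b 1 c d] by (simp add: A'_def B'_def C'_def)
  have "(of_int (a * d - b * c) :: real)\<^sup>2 = 1"
    using det by (metis of_int_abs of_int_1 power2_abs one_power2)
  then have D': "B'\<^sup>2 - 4 * A' * C' = B\<^sup>2 - 4 * A * C"
    by (simp add: A'_def B'_def C'_def discriminant_substitution)
  have z0: "herm A' B' C' z0 1 = 2 * A' + C'"
    by (simp add: herm_def norm_mult)
  have "arsinh (m / (sqrt 2 * sqrt (B\<^sup>2 - 4 * A * C)))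
      \<le> arsinh (\<bar>2 * A' + C'\<bar> / (sqrt 2 * sqrt (B\<^sup>2 - 4 * A * C)))"
    using m[OF det] D by (intro arsinh_mono divide_right_mono) (simp_all add: A'_def C'_def)
  also have "\<dots> \<le> hyp_dist z0 w"
    using arsinh_le_hyp_dist[of B' A' C' z0 w] D D' h' triangle_Im_pos[OF w] z0 by simp
  finally show "arsinh (m / (sqrt 2 * sqrt (B\<^sup>2 - 4 * A * C))) \<le> hyp_dist z0 w" .
qed

end

subsection \<open>The spectrum at the base point\<close>

lemma billiard_value_ge:
  assumes "0 \<le> billiard_dist z B" "billiard_dist z B \<le> arsinh (1 / s)" "s > 0"
  shows "ereal s \<le> billiard_value z B"
proof (cases "sinh (billiard_dist z B) = 0")
  \<comment> \<open>The extended real inverse of 0 is \<infinity>.\<close>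
  case True
  then show ?thesis by (simp add: billiard_value_def)
next
  case False
  then have pos: "sinh (billiard_dist z B) > 0"
    using assms(1) by (simp add: less_le)
  have "sinh (billiard_dist z B) \<le> sinh (arsinh (1 / s))"
    using assms(2) by (simp only: sinh_real_le_iff)
  then have "s \<le> 1 / sinh (billiard_dist z B)"
    using pos assms(3) by (simp add: field_simps)
  then show ?thesis
    using pos by (simp add: billiard_value_def inverse_eq_divide)
qed

lemma billiard_value_greater:
  assumes "0 \<le> billiard_dist z B" "billiard_dist z B < arsinh (1 / s)" "s > 0"
  shows "ereal s < billiard_value z B"
proof (cases "sinh (billiard_dist z B) = 0")
  case True
  then show ?thesis by (simp add: billiard_value_def)
next
  case False
  then have pos: "sinh (billiard_dist z B) > 0"
    using assms(1) by (simp add: less_le)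
  have "sinh (billiard_dist z B) < sinh (arsinh (1 / s))"
    using assms(2) by (simp only: sinh_real_less_iff)
  then have "s < 1 / sinh (billiard_dist z B)"
    using pos assms(3) by (simp add: field_simps)
  then show ?thesis
    using pos by (simp add: billiard_value_def inverse_eq_divide)
qed

lemma billiard_value_le:
  assumes "arsinh (1 / s) \<le> billiard_dist z B" "s > 0"
  shows "billiard_value z B \<le> ereal s"
proof -
  have "sinh (arsinh (1 / s)) \<le> sinh (billiard_dist z B)"
    using assms(1) by (simp only: sinh_real_le_iff)
  then have le: "1 / s \<le> sinh (billiard_dist z B)"
    by simp
  then have pos: "sinh (billiard_dist z B) > 0"
    using assms(2) by (meson divide_pos_pos less_le_trans zero_less_one)
  then have "1 / sinh (billiard_dist z B) \<le> s"
    using le assms(2) by (simp add: field_simps)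
  then show ?thesis
    using pos by (simp add: billiard_value_def inverse_eq_divide)
qed

section \<open>The minimum and its attainment by \<open>C_half\<close>\<close>

lemma billiard_in_modular_billiards:
  "\<alpha> \<noteq> \<beta> \<Longrightarrow> billiard (oriented_geodesic \<alpha> \<beta>) \<in> modular_billiards"
  by (auto simp: modular_billiards_def)

lemma modular_billiard_value_ge:
  assumes "B \<in> modular_billiards"
  shows "ereal (sqrt 8) \<le> billiard_value z0 B"
proof -
  obtain \<alpha> \<beta> where B: "B = billiard (oriented_geodesic \<alpha> \<beta>)" "\<alpha> \<noteq> \<beta>"
    using assms by (auto simp: modular_billiards_def)
  then obtain a b c where "b\<^sup>2 - 4 * a * c > 0" "Field (oriented_geodesic \<alpha> \<beta>) = geo a b c"
    "Id_on (geo a b c) \<subseteq> oriented_geodesic \<alpha> \<beta>"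
    using ex_geodesic_form by blast
  from billiard_dist_bounds[OF this] show ?thesis
    unfolding B(1) by (rule billiard_value_ge) simp
qed

text \<open>Parity: vanishing makes \<open>d\<close> even and, after halving, also \<open>c\<close>,
  which determinant 1 or -1 excludes.\<close>

lemma unimodular_C_half_nonzero:
  fixes a b c d :: int
  assumes det: "\<bar>a * d - b * c\<bar> = 1"
  shows "2 * (2 * a * c - c\<^sup>2) + (2 * b * d - d\<^sup>2) \<noteq> 0"
proof
  assume eq: "2 * (2 * a * c - c\<^sup>2) + (2 * b * d - d\<^sup>2) = 0"
  then have "d\<^sup>2 = 2 * (2 * a * c - c\<^sup>2 + b * d)"
    by (simp add: algebra_simps)
  then have "even (d\<^sup>2)"
    by simp
  then obtain e where e: "d = 2 * e"
    by (auto elim: evenE)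
  have "odd c"
  proof
    assume "even c"
    then have "even (a * d - b * c)"
      using e by simp
    then have "even \<bar>a * d - b * c\<bar>"
      by simp
    then show False
      using det by simp
  qed
  moreover have "c\<^sup>2 = 2 * (a * c + b * e - e\<^sup>2)"
    using eq e by (simp add: power2_eq_square algebra_simps)
  then have "even (c\<^sup>2)"
    by simp
  ultimately show False
    by simp
qed

lemma sqrt_8: "sqrt 8 = 2 * sqrt 2"
  by (rule real_sqrt_unique) (simp_all add: power_mult_distrib)

lemma C_half_in: "C_half \<in> modular_billiards"
  unfolding C_half_def by (rule billiard_in_modular_billiards) simp

lemma C_half_value: "billiard_value z0 C_half = ereal (sqrt 8)"
proof (rule antisym)
  let ?S = "oriented_geodesic (Finite (1/2)) Infinity"
  have F: "Field ?S = geo 0 2 (- 1)" and I: "Id_on (geo 0 2 (- 1)) \<subseteq> ?S"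
    using vertical_geodesic(1,2)[of "1/2"] by simp_all
  have D: "2\<^sup>2 - 4 * 0 * (- 1) > (0 :: real)" by simp
  have m: "1 \<le> \<bar>2 * qform 0 2 (- 1) a c + qform 0 2 (- 1) b d\<bar>" if "\<bar>a * d - b * c\<bar> = 1" for a b c d
  proof -
    have "2 * qform 0 2 (- 1) a c + qform 0 2 (- 1) b d
        = of_int (2 * (2 * a * c - c\<^sup>2) + (2 * b * d - d\<^sup>2))"
      by (simp add: qform_def)
    moreover have "1 \<le> \<bar>2 * (2 * a * c - c\<^sup>2) + (2 * b * d - d\<^sup>2)\<bar>"
      using unimodular_C_half_nonzero[OF that] by linarith
    ultimately show ?thesis
      by (metis of_int_abs of_int_1_le_iff)
  qed
  \<comment> \<open>With discriminant 4, the bound 1 for a nonzero integer gives exactly the radius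
    of the disc.\<close>
  have "sqrt 2 * sqrt (2\<^sup>2 - 4 * 0 * (- 1)) = sqrt 8"
    by (simp add: sqrt_8)
  then have "arsinh (1 / sqrt 8) \<le> billiard_dist z0 C_half"
    using billiard_dist_ge[OF D F I m] by (simp only: C_half_def)
  then show "billiard_value z0 C_half \<le> ereal (sqrt 8)"
    by (rule billiard_value_le) simp
  show "ereal (sqrt 8) \<le> billiard_value z0 C_half"
    by (rule modular_billiard_value_ge[OF C_half_in])
qed

section \<open>The limit point, from semicircles of odd diameter\<close>

text \<open>With \<open>u = 8a\<^sup>2 + 4b\<^sup>2\<close>, \<open>v = 2c\<^sup>2 + d\<^sup>2\<close> and \<open>t = 4ac + 2bd\<close> one has \<open>uv = t\<^sup>2 + 8\<close>,
  so \<open>v (u - N\<^sup>2 v) = t\<^sup>2 - (N v)\<^sup>2 + 8\<close>; and \<open>\<bar>t\<bar> \<noteq> N v\<close> by parity.\<close>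

lemma unimodular_bound:
  fixes a b c d N :: int
  assumes det: "\<bar>a * d - b * c\<bar> = 1" and N: "odd N" "N \<ge> 5"
  shows "2 * N - 9 \<le> \<bar>2 * (4 * a\<^sup>2 - N\<^sup>2 * c\<^sup>2) + (4 * b\<^sup>2 - N\<^sup>2 * d\<^sup>2)\<bar>"
proof -
  define v where "v = 2 * c\<^sup>2 + d\<^sup>2"
  define t where "t = 4 * a * c + 2 * b * d"
  define X where "X = 2 * (4 * a\<^sup>2 - N\<^sup>2 * c\<^sup>2) + (4 * b\<^sup>2 - N\<^sup>2 * d\<^sup>2)"
  have "c \<noteq> 0 \<or> d \<noteq> 0"
    using det by auto
  then have "v > 0"
    by (elim disjE) (simp_all add: v_def add_pos_nonneg add_nonneg_pos)
  then have v: "v \<ge> 1" by simp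
  have "(a * d - b * c)\<^sup>2 = 1"
    using det by (metis power2_abs one_power2)
  then have Xv: "X * v = \<bar>t\<bar> * \<bar>t\<bar> - (N * v) * (N * v) + 8"
    unfolding abs_mult_self X_def v_def t_def by algebra
  \<comment> \<open>Equality would make \<open>v\<close> and hence \<open>d\<close> even, so
    \<open>c\<close> is odd; halving both sides then equates an even and an odd number.\<close>
  have ne: "\<bar>t\<bar> \<noteq> N * v"
  proof
    assume eq: "\<bar>t\<bar> = N * v"
    have "even \<bar>t\<bar>"
      by (simp add: t_def)
    then have "even v"
      using eq N by simp
    then have d: "even d"
      by (simp add: v_def)
    have c: "odd c"
    proof
      assume "even c"
      then have "even \<bar>a * d - b * c\<bar>"
        using d by simp
      then show False
        using det by simp
    qed
    obtain e where e: "d = 2 * e"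
      using d by (auto elim: evenE)
    have "N * v = 2 * (N * (c\<^sup>2 + 2 * e\<^sup>2))"
      by (simp add: v_def e algebra_simps)
    moreover have "t = 2 * (2 * (a * c + b * e))"
      by (simp add: t_def e)
    then have "\<bar>t\<bar> = 2 * \<bar>2 * (a * c + b * e)\<bar>"
      by (simp only: abs_mult abs_numeral)
    ultimately have "\<bar>2 * (a * c + b * e)\<bar> = N * (c\<^sup>2 + 2 * e\<^sup>2)"
      using eq by linarith
    moreover have "odd (N * (c\<^sup>2 + 2 * e\<^sup>2))"
      using N c by simp
    ultimately show False
      by (metis dvd_abs_iff dvd_triv_left)
  qed
  have Nv: "N * v > 0"
    using N v by simp
  have "2 * N - 9 \<le> \<bar>X\<bar>"
  \<comment> \<open>The integers \<open>\<bar>t\<bar>\<close> and \<open>N * v\<close> differ by at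
    least 1, so their squares differ by at least \<open>2 * N * v - 1\<close>. The summand 8 turns
    this into \<open>2 * N * v - 9\<close>, and \<open>v \<ge> 1\<close> permits division by
    \<open>v\<close>.\<close>
  proof (cases "\<bar>t\<bar> < N * v")
    case True
    then have "\<bar>t\<bar> * \<bar>t\<bar> \<le> (N * v - 1) * (N * v - 1)"
      by (intro mult_mono) auto
    then have "- X * v \<ge> 2 * (N * v) - 9"
      using Xv by (simp add: algebra_simps)
    then have "(2 * N - 9) * v \<le> (- X) * v"
      using v by (simp add: algebra_simps)
    then have "2 * N - 9 \<le> - X"
      by (rule mult_right_le_imp_le) (use v in simp)
    then show ?thesis by linarith
  next
    case False
    then have "(N * v + 1) * (N * v + 1) \<le> \<bar>t\<bar> * \<bar>t\<bar>"
      using ne Nv by (intro mult_mono) auto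
    then have "X * v \<ge> 2 * (N * v) + 9"
      using Xv by (simp add: algebra_simps)
    then have "(2 * N) * v \<le> X * v"
      by (simp add: algebra_simps)
    then have "2 * N \<le> X"
      by (rule mult_right_le_imp_le) (use v in simp)
    then show ?thesis by linarith
  qed
  then show ?thesis
    by (simp add: X_def)
qed

text \<open>The end points are \<open>-N/2\<close> and \<open>N/2\<close> with
  \<open>N = 2 * k + 1\<close>, so \<open>N\<close> is always odd.\<close>

definition semicircle_billiard :: "nat \<Rightarrow> complex rel set" where
  "semicircle_billiard k =
     billiard (oriented_geodesic (Finite (- (real k + 1/2))) (Finite (real k + 1/2)))"

lemma semicircle_geodesic:
  defines "S k \<equiv> oriented_geodesic (Finite (- (real k + 1/2))) (Finite (real k + 1/2))"
  shows "Field (S k) = geo 1 0 (- (real k + 1/2)\<^sup>2)" "Id_on (geo 1 0 (- (real k + 1/2)\<^sup>2)) \<subseteq> S k"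
proof -
  have "geo 1 (- (- (real k + 1/2) + (real k + 1/2))) (- (real k + 1/2) * (real k + 1/2))
      = geo 1 0 (- (real k + 1/2)\<^sup>2)"
    by (simp only: add.left_inverse minus_zero mult_minus_left power2_eq_square)
  then show "Field (S k) = geo 1 0 (- (real k + 1/2)\<^sup>2)" "Id_on (geo 1 0 (- (real k + 1/2)\<^sup>2)) \<subseteq> S k"
    using circular_geodesic[of "- (real k + 1/2)" "real k + 1/2"] by (simp_all only: S_def)
qed

lemma semicircle_billiard_in: "semicircle_billiard k \<in> modular_billiards"
  unfolding semicircle_billiard_def by (rule billiard_in_modular_billiards) simp

lemma semicircle_billiard_le:
  assumes k: "k \<ge> 4"
  shows "billiard_value z0 (semicircle_billiard k)
    \<le> ereal (sqrt 2 * (8 * real k + 4) / (4 * real k - 7))"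
proof -
  define C where "C = - (real k + 1/2)\<^sup>2"
  \<comment> \<open>Here \<open>4 * k - 7 = 2 * N - 9\<close>, and the division by 4 undoes the
    scaling that makes the form integral.\<close>
  define m where "m = (4 * real k - 7) / 4"
  have DC: "0\<^sup>2 - 4 * 1 * C = (2 * real k + 1)\<^sup>2"
    by (simp add: C_def power2_eq_square algebra_simps)
  have D: "0\<^sup>2 - 4 * 1 * C > 0"
    unfolding DC by (intro zero_less_power) simp
  have m: "m \<le> \<bar>2 * qform 1 0 C a c + qform 1 0 C b d\<bar>" if "\<bar>a * d - b * c\<bar> = 1" for a b c d
  proof -
    define N where "N = 2 * int k + 1"
    define X where "X = 2 * (4 * a\<^sup>2 - N\<^sup>2 * c\<^sup>2) + (4 * b\<^sup>2 - N\<^sup>2 * d\<^sup>2)"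
    have "2 * N - 9 \<le> \<bar>X\<bar>"
      unfolding X_def using that k by (intro unimodular_bound) (auto simp: N_def)
    then have "real_of_int (2 * N - 9) \<le> \<bar>real_of_int X\<bar>"
      by linarith
    moreover have eq: "2 * qform 1 0 C a c + qform 1 0 C b d = real_of_int X / 4"
      by (simp add: qform_def C_def X_def N_def power2_eq_square field_simps)
    moreover have "\<bar>2 * qform 1 0 C a c + qform 1 0 C b d\<bar> = \<bar>real_of_int X\<bar> / 4"
      unfolding eq by simp
    ultimately show ?thesis
      by (simp add: m_def N_def)
  qed
  have "arsinh (m / (sqrt 2 * (2 * real k + 1))) \<le> billiard_dist z0 (semicircle_billiard k)"
    using billiard_dist_ge[OF D semicircle_geodesic[of k, folded C_def] m, unfolded DC]
    by (simp add: semicircle_billiard_def)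
  moreover have "m / (sqrt 2 * (2 * real k + 1)) = 1 / (sqrt 2 * (8 * real k + 4) / (4 * real k - 7))"
    using k by (simp add: m_def field_simps)
  ultimately show ?thesis
    using k by (intro billiard_value_le) auto
qed

text \<open>The semicircle translated to have its right end point at \<open>1/2\<close> passes through the
  interior of the disc at height \<open>3/2\<close>.\<close>

lemma semicircle_billiard_greater:
  assumes k: "k \<ge> 2"
  shows "ereal (sqrt 8) < billiard_value z0 (semicircle_billiard k)"
proof -
  let ?S = "oriented_geodesic (Finite (- (real k + 1/2))) (Finite (real k + 1/2))"
  define C where "C = - (real k + 1/2)\<^sup>2"
  have D: "0\<^sup>2 - 4 * 1 * C > 0"
    by (simp add: C_def)
  note FI = semicircle_geodesic[of k, folded C_def]
  \<comment> \<open>The abscissa at which the semicircle has height 3/2. It lies in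
    \<open>[k, k + 1/2)\<close>, the lower bound using \<open>k \<ge> 2\<close>.\<close>
  define y where "y = sqrt ((real k + 1/2)\<^sup>2 - 9/4)"
  have k2: "(real k)\<^sup>2 \<le> (real k + 1/2)\<^sup>2 - 9/4"
    using k by (simp add: power2_eq_square algebra_simps)
  have y2: "y\<^sup>2 = (real k + 1/2)\<^sup>2 - 9/4"
    unfolding y_def by (intro real_sqrt_pow2) (use k2 zero_le_power2[of "real k"] in linarith)
  have "real k \<le> y"
    unfolding y_def using k2 by (rule real_le_rsqrt)
  moreover have "y < real k + 1/2"
    unfolding y_def by (rule real_less_lsqrt) auto
  ultimately have x: "0 \<le> y - real k" "y - real k < 1/2"
    by auto
  define w where "w = Complex (y - real k) (3/2)"
  have "w - Complex 0 (3/2) = of_real (y - real k)"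
    by (simp add: w_def complex_eq_iff)
  then have "cmod (w - Complex 0 (3/2)) = \<bar>y - real k\<bar>"
    by (metis norm_of_real)
  then have T: "w \<in> fundamental_triangle"
    using x by (intro half_disc_in_triangle) (auto simp: w_def)
  have "of_int 1 * w + of_int (int k) = Complex y (3/2)"
    by (simp add: w_def complex_eq_iff)
  then have "herm 1 0 C (of_int 1 * w + of_int (int k)) (of_int 0 * w + of_int 1) = 0"
    using y2 by (simp add: herm_def cmod_power2 C_def power_divide)
  moreover have "\<bar>1 * 1 - int k * 0\<bar> = 1" by simp
  ultimately have "w \<in> billiard_points (billiard ?S)"
    unfolding billiard_points_eq[OF FI] using T by blast
  then have "billiard_dist z0 (billiard ?S) \<le> hyp_dist z0 w"
    by (rule billiard_dist_le)
  also have "\<dots> < arsinh (1 / sqrt 8)"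
  proof (rule hyp_dist_disc_less)
    have "(y - real k)\<^sup>2 < (1/2)\<^sup>2"
      using x by (intro power_strict_mono) auto
    then show "(Re w)\<^sup>2 + (Im w)\<^sup>2 + 2 < 3 * Im w"
      by (simp add: w_def power_divide)
  qed (simp add: w_def)
  finally have "billiard_dist z0 (billiard ?S) < arsinh (1 / sqrt 8)" .
  then show ?thesis
    using billiard_dist_bounds(1)[OF D FI] unfolding semicircle_billiard_def
    by (intro billiard_value_greater) auto
qed

text \<open>The values are squeezed onto \<open>sqrt 8\<close>, and their strict excess keeps them
  different from it. The shift by 4 makes the upper bound available at every index.\<close>

lemma sqrt8_islimpt: "ereal (sqrt 8) islimpt billiard_spectrum z0"
  unfolding islimpt_sequential
proof (intro exI conjI allI)
  let ?f = "\<lambda>n. billiard_value z0 (semicircle_billiard (n + 4))"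
  show "?f n \<in> billiard_spectrum z0 - {ereal (sqrt 8)}" for n
    using semicircle_billiard_in semicircle_billiard_greater[of "n + 4"]
    by (auto simp: billiard_spectrum_def)
  have "(\<lambda>n. (8 * real (n + 4) + 4) / (4 * real (n + 4) - 7)) \<longlonglongrightarrow> 2"
    by real_asymp
  then have "(\<lambda>n. sqrt 2 * ((8 * real (n + 4) + 4) / (4 * real (n + 4) - 7))) \<longlonglongrightarrow> sqrt 2 * 2"
    by (rule tendsto_mult_left)
  also have "sqrt 2 * 2 = sqrt 8"
    by (simp only: sqrt_8 mult.commute)
  finally have lim: "(\<lambda>n. ereal (sqrt 2 * (8 * real (n + 4) + 4) / (4 * real (n + 4) - 7))) \<longlonglongrightarrow> ereal (sqrt 8)"
    by simp
  show "?f \<longlonglongrightarrow> ereal (sqrt 8)"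
  proof (rule tendsto_sandwich[OF _ _ tendsto_const lim])
    show "\<forall>\<^sub>F n in sequentially. ereal (sqrt 8) \<le> ?f n"
      using semicircle_billiard_greater by (auto intro!: always_eventually less_imp_le)
    show "\<forall>\<^sub>F n in sequentially. ?f n \<le> ereal (sqrt 2 * (8 * real (n + 4) + 4) / (4 * real (n + 4) - 7))"
      by (intro always_eventually allI semicircle_billiard_le) simp
  qed
qed

theorem theorem2p1:
  shows "C_half \<in> modular_billiards
    \<and> billiard_value (\<i> * of_real (sqrt 2)) C_half = ereal (sqrt 8)
    \<and> (\<forall>B\<in>modular_billiards. billiard_value (\<i> * of_real (sqrt 2)) B \<ge> ereal (sqrt 8))
    \<and> ereal (sqrt 8) islimpt billiard_spectrum (\<i> * of_real (sqrt 2))"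
  using C_half_in C_half_value modular_billiard_value_ge sqrt8_islimpt by blast

end
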